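(* Problem (E), the single-level problem with combinatorial consistency cuts and Benders optimality cuts, is equivalent to the bilevel design problem (B) for On-Demand Multimodal Transit Systems (both problems are defined in the context).
   Context: **Data.** $N$ is a set of nodes (bus stops), $H\subseteq N$ a set of hubs, $T$ the set of trips, $T'\subseteq T$ the trips with mode choice. Each trip $r\in T$ has an origin $or^r\in N$, a destination $de^r\in N$, and a number of riders $p^r\in\mathbb Z_{+}$. For $i,j\in N$, $t_{ij}$ and $d_{ij}$ are travel time and distance (possibly asymmetric), assumed to satisfy the triangle inequality. $\theta\in[0,1]$ is a weight, $g$ the shuttle cost per mile, $s$ the average waiting time of a bus, $\rho$ the bus cost per mile, $n$ the number of buses per open leg, $\phi$ the ticket price. Put $\varphi=(1-\theta)\phi$, $\beta_{hl}=(1-\theta)\rho\, n\, d_{hl}$, $\gamma^r_{ij}=(1-\theta)g\,d_{ij}+\theta t_{ij}$, $\tau^r_{hl}=\theta(t_{hl}+s)$. For $r\in T'$, $\alpha^r$ is a parameter of the rider and $t^r_{cur}$ is her direct trip duration with her personal vehicle. **Follower problem** of trip $r$ for a given design $\mathbf z\in\{0,1\}^{|H|\times|H|}$: lexicographically minimize $\langle b^r,f^r\rangle$ (first $b^r$, then $f^r$) over binary $x^r_{hl}$ ($h,l\in H$) and $y^r_{ij}$ ($i,j\in N$), where $b^r=\sum_{h,l\in H}\tau^r_{hl}x^r_{hl}+\sum_{i,j\in N}\gamma^r_{ij}y^r_{ij}$ and $f^r=\sum_{h,l\in H}(t_{hl}+s)x^r_{hl}+\sum_{i,j\in N}t_{ij}y^r_{ij}$,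 subject to $x^r_{hl}\le z_{hl}$ for all $h,l\in H$ and flow conservation: for each $i\in N$, $\sum_{h\in H}(x^r_{ih}-x^r_{hi})$ (present only if $i\in H$) $+\sum_{j\in N}(y^r_{ij}-y^r_{ji})$ equals $1$ if $i=or^r$, $-1$ if $i=de^r$, and $0$ otherwise. For given $\mathbf z$ the lexicographic minimum is unique. Let $A^r$ be the set of shuttle arcs $(or^r,h)$ and $(h,de^r)$ for $h\in H$, and $(or^r,de^r)$; by the triangle inequality only these shuttle arcs need to be considered. **Choice function.** For $r\in T'$ and a route $(\mathbf x^r,\mathbf y^r)$ with inconvenience $f^r$, ${\cal C}^r(\mathbf x^r,\mathbf y^r)=1$ if $f^r\le\alpha^r t^r_{cur}$ and $0$ otherwise. Since all lexicographic minimizers under a design $\mathbf z$ have the same $f^r$, the value at a lexicographic minimizer depends only on $\mathbf z$ and is written ${\cal C}^r(\mathbf z)$. **Problem (B).** Minimize $$\sum_{h,l\in H}\beta_{hl}z_{hl}+\sum_{r\in T\setminus T'}p^rb^r+\sum_{r\in T'}p^r\delta^r(b^r-\varphi)$$ subject to $\sum_{l\in H}z_{hl}=\sum_{l\in H}z_{lh}$ for all $h\in H$, $\delta^r={\cal C}^r(\mathbf x^r,\mathbf y^r)$ for all $r\in T'$, $z_{hl}\in\{0,1\}$ for all $h,l\in H$, $\delta^r\in\{0,1\}$ for all $r\in T'$, where for each $r\in T$, $(\mathbf x^r,\mathbf y^r,b^r)$ is a solution of the follower problem of $r$ under $\mathbf z$. **Scaled dual subproblem.** Let $M$ be a suitably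 large constant, so that the follower problem can be solved as a linear program with objective $Mb^r+f^r$, and put $\hat\tau^r_{hl}=M\tau^r_{hl}+t_{hl}+s$, $\hat\gamma^r_{ij}=M\gamma^r_{ij}+t_{ij}$. For a design $\bar{\mathbf z}$, the dual subproblem of trip $r$ is to maximize $(u^r_{or^r}-u^r_{de^r})-\sum_{h,l\in H}\bar z_{hl}v^r_{hl}$ over the polyhedron $D^r$ of all $(u^r,v^r)$ with $u^r_h-u^r_l-v^r_{hl}\le\hat\tau^r_{hl}$ for all $h,l\in H$, $u^r_i-u^r_j\le\hat\gamma^r_{ij}$ for all $(i,j)\in A^r$, $u^r_i\ge0$ for all $i\in N$, and $v^r_{hl}\ge0$ for all $h,l\in H$. **Problem (E).** Minimize the same objective as in (B) over $\mathbf z$, $\boldsymbol\delta$ and real variables $b^r$ ($r\in T$), subject to $\sum_{l\in H}z_{hl}=\sum_{l\in H}z_{lh}$ for all $h\in H$, $z_{hl}\in\{0,1\}$, $\delta^r\in\{0,1\}$, and: (1) consistency cuts: for each $r\in T'$ and each design $\bar{\mathbf z}\in\{0,1\}^{|H|\times|H|}$, $\sum_{(h,l):\bar z_{hl}=0}z_{hl}+\sum_{(h,l):\bar z_{hl}=1}(1-z_{hl})\ge\delta^r$ if ${\cal C}^r(\bar{\mathbf z})=0$, and $\sum_{(h,l):\bar z_{hl}=0}z_{hl}+\sum_{(h,l):\bar z_{hl}=1}(1-z_{hl})+\delta^r\ge 1$ if ${\cal C}^r(\bar{\mathbf z})=1$; (2) optimality cuts: for each $r\in T$ and each vertex $(\bar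 u^r,\bar v^r)$ of $D^r$, $$b^r\ge(\bar u^r_{or^r}-\bar u^r_{de^r})-\sum_{h,l\in H}z_{hl}\bar v^r_{hl}.$$
   Formalization: Scaled cuts bound Mb+f, not b, so the literal claim fails; it is proved with unscaled dual costs, and with scaled cuts when b in both objectives means Mb+f. That only the shuttle arcs in A^r matter is assumed (automatic if the follower uses only A^r). *)

theory Defs
  imports "HOL-Analysis.Analysis"
begin

text \<open>
  The node set \<open>N\<close> is the finite type \<open>'n\<close>. Matrices indexed by \<open>H \<times> H\<close> are functions of which only
  the values on hubs are used. Arc costs carry no trip index because they do not depend on the trip.

  The field \<open>shuttles r\<close> is the set of shuttle arcs offered to trip \<open>r\<close>. It is \<open>UNIV\<close> when there is a
  variable \<open>y\<^sub>i\<^sub>j\<close> for all \<open>i, j \<in> N\<close>, and \<open>direct_arcs I r\<close>, i.e. the arcs in \<open>A\<close> of the trip, when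
  the other shuttle variables are left out of the follower problem.
\<close>

record ('n, 'r) odmts =
  hubs :: "'n set"
  trips :: "'r set"
  choice_trips :: "'r set"
  orig :: "'r \<Rightarrow> 'n"
  dest :: "'r \<Rightarrow> 'n"
  riders :: "'r \<Rightarrow> nat"
  shuttles :: "'r \<Rightarrow> ('n \<times> 'n) set"
  time :: "'n \<Rightarrow> 'n \<Rightarrow> real"
  miles :: "'n \<Rightarrow> 'n \<Rightarrow> real"
  theta :: real
  shuttle_rate :: real
  wait :: real
  bus_rate :: real
  buses :: nat
  ticket :: real
  tolerance :: "'r \<Rightarrow> real"  \<comment> \<open>the rider parameter \<open>\<alpha>\<close>\<close>
  t_cur :: "'r \<Rightarrow> real"

definition fare :: "('n, 'r) odmts \<Rightarrow> real" where
  "fare I = (1 - theta I) * ticket I"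

definition beta :: "('n, 'r) odmts \<Rightarrow> 'n \<Rightarrow> 'n \<Rightarrow> real" where
  "beta I h l = (1 - theta I) * bus_rate I * real (buses I) * miles I h l"

definition gamma :: "('n, 'r) odmts \<Rightarrow> 'n \<Rightarrow> 'n \<Rightarrow> real" where
  "gamma I i j = (1 - theta I) * shuttle_rate I * miles I i j + theta I * time I i j"

definition tau :: "('n, 'r) odmts \<Rightarrow> 'n \<Rightarrow> 'n \<Rightarrow> real" where
  "tau I h l = theta I * (time I h l + wait I)"

definition tau_hat :: "('n, 'r) odmts \<Rightarrow> real \<Rightarrow> 'n \<Rightarrow> 'n \<Rightarrow> real" where
  "tau_hat I M h l = M * tau I h l + time I h l + wait I"

definition gamma_hat :: "('n, 'r) odmts \<Rightarrow> real \<Rightarrow> 'n \<Rightarrow> 'n \<Rightarrow> real" where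
  "gamma_hat I M i j = M * gamma I i j + time I i j"

definition direct_arcs :: "('n, 'r) odmts \<Rightarrow> 'r \<Rightarrow> ('n \<times> 'n) set" where
  "direct_arcs I r = (\<lambda>h. (orig I r, h)) ` hubs I \<union> (\<lambda>h. (h, dest I r)) ` hubs I
     \<union> {(orig I r, dest I r)}"

definition odmts_instance :: "('n::finite, 'r) odmts \<Rightarrow> bool" where
  "odmts_instance I \<longleftrightarrow>
     finite (trips I) \<and> choice_trips I \<subseteq> trips I \<and>
     (\<forall>r\<in>trips I. orig I r \<noteq> dest I r) \<and>
     (\<forall>r\<in>trips I. direct_arcs I r \<subseteq> shuttles I r) \<and>
     (\<forall>i j. 0 \<le> time I i j) \<and> (\<forall>i j. 0 \<le> miles I i j) \<and>
     (\<forall>i j k. time I i k \<le> time I i j + time I j k) \<and>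
     (\<forall>i j k. miles I i k \<le> miles I i j + miles I j k) \<and>
     0 \<le> theta I \<and> theta I \<le> 1 \<and> 0 \<le> shuttle_rate I \<and> 0 \<le> wait I"

subsection \<open>Follower problem\<close>

definition is_design :: "('n, 'r) odmts \<Rightarrow> ('n \<Rightarrow> 'n \<Rightarrow> real) \<Rightarrow> bool" where
  "is_design I z \<longleftrightarrow> (\<forall>h\<in>hubs I. \<forall>l\<in>hubs I. z h l \<in> {0, 1})"

definition route_cost ::
  "('n::finite, 'r) odmts \<Rightarrow> ('n \<Rightarrow> 'n \<Rightarrow> real) \<Rightarrow> ('n \<Rightarrow> 'n \<Rightarrow> real)
     \<Rightarrow> ('n \<Rightarrow> 'n \<Rightarrow> real) \<Rightarrow> ('n \<Rightarrow> 'n \<Rightarrow> real) \<Rightarrow> real" where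
  "route_cost I bus shuttle x y =
     (\<Sum>h\<in>hubs I. \<Sum>l\<in>hubs I. bus h l * x h l) + (\<Sum>i\<in>UNIV. \<Sum>j\<in>UNIV. shuttle i j * y i j)"

abbreviation ride_cost ::
  "('n::finite, 'r) odmts \<Rightarrow> ('n \<Rightarrow> 'n \<Rightarrow> real) \<Rightarrow> ('n \<Rightarrow> 'n \<Rightarrow> real) \<Rightarrow> real" where
  "ride_cost I \<equiv> route_cost I (tau I) (gamma I)"

abbreviation inconvenience ::
  "('n::finite, 'r) odmts \<Rightarrow> ('n \<Rightarrow> 'n \<Rightarrow> real) \<Rightarrow> ('n \<Rightarrow> 'n \<Rightarrow> real) \<Rightarrow> real" where
  "inconvenience I \<equiv> route_cost I (\<lambda>h l. time I h l + wait I) (time I)"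

definition follower_feasible ::
  "('n::finite, 'r) odmts \<Rightarrow> 'r \<Rightarrow> ('n \<Rightarrow> 'n \<Rightarrow> real)
     \<Rightarrow> ('n \<Rightarrow> 'n \<Rightarrow> real) \<Rightarrow> ('n \<Rightarrow> 'n \<Rightarrow> real) \<Rightarrow> bool" where
  "follower_feasible I r z x y \<longleftrightarrow>
     (\<forall>h\<in>hubs I. \<forall>l\<in>hubs I. x h l \<in> {0, 1} \<and> x h l \<le> z h l) \<and>
     (\<forall>i j. y i j \<in> {0, 1}) \<and>
     (\<forall>i j. (i, j) \<notin> shuttles I r \<longrightarrow> y i j = 0) \<and>
     (\<forall>i. (if i \<in> hubs I then \<Sum>h\<in>hubs I. x i h - x h i else 0) + (\<Sum>j\<in>UNIV. y i j - y j i)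
            = (if i = orig I r then 1 else if i = dest I r then -1 else 0))"

definition lex_le :: "real \<times> real \<Rightarrow> real \<times> real \<Rightarrow> bool" where
  "lex_le p q \<longleftrightarrow> fst p < fst q \<or> (fst p = fst q \<and> snd p \<le> snd q)"

definition follower_solution ::
  "('n::finite, 'r) odmts \<Rightarrow> 'r \<Rightarrow> ('n \<Rightarrow> 'n \<Rightarrow> real)
     \<Rightarrow> ('n \<Rightarrow> 'n \<Rightarrow> real) \<Rightarrow> ('n \<Rightarrow> 'n \<Rightarrow> real) \<Rightarrow> bool" where
  "follower_solution I r z x y \<longleftrightarrow>
     follower_feasible I r z x y \<and>
     (\<forall>x' y'. follower_feasible I r z x' y' \<longrightarrow>
        lex_le (ride_cost I x y, inconvenience I x y) (ride_cost I x' y', inconvenience I x' y'))"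

text \<open>Only the shuttle arcs in \<open>A\<close> need to be considered: every route is matched by one that uses
  only these and is lexicographically no worse. The triangle inequality alone does not give this when
  \<open>shuttles r\<close> is \<open>UNIV\<close>: a shuttle between two hubs can link two bus legs.\<close>

definition direct_arcs_suffice :: "('n::finite, 'r) odmts \<Rightarrow> bool" where
  "direct_arcs_suffice I \<longleftrightarrow>
     (\<forall>r\<in>trips I. \<forall>z x y. is_design I z \<and> follower_feasible I r z x y \<longrightarrow>
        (\<exists>x' y'. follower_feasible I r z x' y' \<and>
           (\<forall>i j. (i, j) \<notin> direct_arcs I r \<longrightarrow> y' i j = 0) \<and>
           lex_le (ride_cost I x' y', inconvenience I x' y') (ride_cost I x y, inconvenience I x y)))"

lemma direct_arcs_suffice_trivial:
  assumes "\<And>r. r \<in> trips I \<Longrightarrow> shuttles I r = direct_arcs I r"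
  shows "direct_arcs_suffice I"
  unfolding direct_arcs_suffice_def
proof (intro ballI allI impI)
  fix r z x y
  assume r: "r \<in> trips I" and xy: "is_design I z \<and> follower_feasible I r z x y"
  from xy have "\<forall>i j. (i, j) \<notin> direct_arcs I r \<longrightarrow> y i j = 0"
    unfolding follower_feasible_def assms[OF r] by blast
  moreover have "lex_le (ride_cost I x y, inconvenience I x y) (ride_cost I x y, inconvenience I x y)"
    by (simp add: lex_le_def)
  ultimately show "\<exists>x' y'. follower_feasible I r z x' y' \<and>
      (\<forall>i j. (i, j) \<notin> direct_arcs I r \<longrightarrow> y' i j = 0) \<and>
      lex_le (ride_cost I x' y', inconvenience I x' y') (ride_cost I x y, inconvenience I x y)"
    using xy by blast
qed

text \<open>\<open>M\<close> is large enough if minimizing \<open>M b + f\<close> solves the lexicographic problem.\<close>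

definition suitably_large :: "('n::finite, 'r) odmts \<Rightarrow> real \<Rightarrow> bool" where
  "suitably_large I M \<longleftrightarrow> 0 < M \<and>
     (\<forall>r\<in>trips I. \<forall>z x y. is_design I z \<and> follower_feasible I r z x y \<and>
        (\<forall>x' y'. follower_feasible I r z x' y' \<longrightarrow>
           M * ride_cost I x y + inconvenience I x y \<le> M * ride_cost I x' y' + inconvenience I x' y')
        \<longrightarrow> follower_solution I r z x y)"

definition choice ::
  "('n::finite, 'r) odmts \<Rightarrow> 'r \<Rightarrow> ('n \<Rightarrow> 'n \<Rightarrow> real) \<Rightarrow> ('n \<Rightarrow> 'n \<Rightarrow> real) \<Rightarrow> real" where
  "choice I r x y = (if inconvenience I x y \<le> tolerance I r * t_cur I r then 1 else 0)"

text \<open>All follower solutions under \<open>z\<close> have the same inconvenience, so the value below does not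
  depend on the one that is picked.\<close>

definition design_choice ::
  "('n::finite, 'r) odmts \<Rightarrow> 'r \<Rightarrow> ('n \<Rightarrow> 'n \<Rightarrow> real) \<Rightarrow> real" where
  "design_choice I r z = (case (SOME (x, y). follower_solution I r z x y) of (x, y) \<Rightarrow> choice I r x y)"

subsection \<open>Bilevel problem\<close>

definition objective ::
  "('n, 'r) odmts \<Rightarrow> ('n \<Rightarrow> 'n \<Rightarrow> real) \<Rightarrow> ('r \<Rightarrow> real) \<Rightarrow> ('r \<Rightarrow> real) \<Rightarrow> real" where
  "objective I z \<delta> b =
     (\<Sum>h\<in>hubs I. \<Sum>l\<in>hubs I. beta I h l * z h l)
     + (\<Sum>r\<in>trips I - choice_trips I. real (riders I r) * b r)
     + (\<Sum>r\<in>choice_trips I. real (riders I r) * \<delta> r * (b r - fare I))"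

definition leader_feasible ::
  "('n, 'r) odmts \<Rightarrow> ('n \<Rightarrow> 'n \<Rightarrow> real) \<Rightarrow> ('r \<Rightarrow> real) \<Rightarrow> bool" where
  "leader_feasible I z \<delta> \<longleftrightarrow>
     (\<forall>h\<in>hubs I. (\<Sum>l\<in>hubs I. z h l) = (\<Sum>l\<in>hubs I. z l h)) \<and>
     is_design I z \<and> (\<forall>r\<in>choice_trips I. \<delta> r \<in> {0, 1})"

definition B_feasible ::
  "('n::finite, 'r) odmts \<Rightarrow> ('n \<Rightarrow> 'n \<Rightarrow> real) \<Rightarrow> ('r \<Rightarrow> real)
     \<Rightarrow> ('r \<Rightarrow> 'n \<Rightarrow> 'n \<Rightarrow> real) \<Rightarrow> ('r \<Rightarrow> 'n \<Rightarrow> 'n \<Rightarrow> real) \<Rightarrow> bool" where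
  "B_feasible I z \<delta> x y \<longleftrightarrow>
     leader_feasible I z \<delta> \<and>
     (\<forall>r\<in>trips I. follower_solution I r z (x r) (y r)) \<and>
     (\<forall>r\<in>choice_trips I. \<delta> r = choice I r (x r) (y r))"

text \<open>The arguments \<open>bus\<close> and \<open>shuttle\<close> are the arc costs in which the trip values \<open>b\<close> of the
  objective are measured; problem (B) itself is the case \<open>tau I\<close>, \<open>gamma I\<close>. With
  \<open>tau_hat I M\<close>, \<open>gamma_hat I M\<close>, the trip value is the optimal value of the scaled follower problem.
  The follower solutions are the lexicographic minimizers in both cases. The two must not be mixed:
  cuts from the scaled dual bound \<open>M b + f\<close>, not \<open>b\<close>.\<close>

definition B_objective ::
  "('n::finite, 'r) odmts \<Rightarrow> ('n \<Rightarrow> 'n \<Rightarrow> real) \<Rightarrow> ('n \<Rightarrow> 'n \<Rightarrow> real) \<Rightarrow> ('n \<Rightarrow> 'n \<Rightarrow> real) \<Rightarrow> ('r \<Rightarrow> real)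
     \<Rightarrow> ('r \<Rightarrow> 'n \<Rightarrow> 'n \<Rightarrow> real) \<Rightarrow> ('r \<Rightarrow> 'n \<Rightarrow> 'n \<Rightarrow> real) \<Rightarrow> real" where
  "B_objective I bus shuttle z \<delta> x y = objective I z \<delta> (\<lambda>r. route_cost I bus shuttle (x r) (y r))"

definition B_optimal ::
  "('n::finite, 'r) odmts \<Rightarrow> ('n \<Rightarrow> 'n \<Rightarrow> real) \<Rightarrow> ('n \<Rightarrow> 'n \<Rightarrow> real) \<Rightarrow> ('n \<Rightarrow> 'n \<Rightarrow> real) \<Rightarrow> ('r \<Rightarrow> real)
     \<Rightarrow> ('r \<Rightarrow> 'n \<Rightarrow> 'n \<Rightarrow> real) \<Rightarrow> ('r \<Rightarrow> 'n \<Rightarrow> 'n \<Rightarrow> real) \<Rightarrow> bool" where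
  "B_optimal I bus shuttle z \<delta> x y \<longleftrightarrow>
     B_feasible I z \<delta> x y \<and>
     (\<forall>z' \<delta>' x' y'. B_feasible I z' \<delta>' x' y' \<longrightarrow>
        B_objective I bus shuttle z \<delta> x y \<le> B_objective I bus shuttle z' \<delta>' x' y')"

subsection \<open>Single-level problem\<close>

text \<open>The coordinates of \<open>v\<close> outside \<open>H \<times> H\<close> are fixed to zero, so that extreme points of this set
  correspond to the vertices of the polyhedron in the coordinates \<open>u\<^sub>i\<close> \<open>(i \<in> N)\<close> and \<open>v\<^sub>h\<^sub>l\<close>
  \<open>(h, l \<in> H)\<close>.\<close>

definition dual_polyhedron ::
  "('n::finite, 'r) odmts \<Rightarrow> ('n \<Rightarrow> 'n \<Rightarrow> real) \<Rightarrow> ('n \<Rightarrow> 'n \<Rightarrow> real) \<Rightarrow> 'r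
     \<Rightarrow> ((real^'n) \<times> (real^('n \<times> 'n))) set" where
  "dual_polyhedron I bus shuttle r =
     {(u, v). (\<forall>h\<in>hubs I. \<forall>l\<in>hubs I. u $ h - u $ l - v $ (h, l) \<le> bus h l) \<and>
              (\<forall>(i, j)\<in>direct_arcs I r. u $ i - u $ j \<le> shuttle i j) \<and>
              (\<forall>i. 0 \<le> u $ i) \<and>
              (\<forall>h\<in>hubs I. \<forall>l\<in>hubs I. 0 \<le> v $ (h, l)) \<and>
              (\<forall>h l. (h, l) \<notin> hubs I \<times> hubs I \<longrightarrow> v $ (h, l) = 0)}"

definition consistency_cuts ::
  "('n::finite, 'r) odmts \<Rightarrow> ('n \<Rightarrow> 'n \<Rightarrow> real) \<Rightarrow> ('r \<Rightarrow> real) \<Rightarrow> bool" where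
  "consistency_cuts I z \<delta> \<longleftrightarrow>
     (\<forall>r\<in>choice_trips I. \<forall>zb. is_design I zb \<longrightarrow>
        (design_choice I r zb = 0 \<longrightarrow>
           (\<Sum>(h, l) | (h, l) \<in> hubs I \<times> hubs I \<and> zb h l = 0. z h l)
           + (\<Sum>(h, l) | (h, l) \<in> hubs I \<times> hubs I \<and> zb h l = 1. 1 - z h l) \<ge> \<delta> r) \<and>
        (design_choice I r zb = 1 \<longrightarrow>
           (\<Sum>(h, l) | (h, l) \<in> hubs I \<times> hubs I \<and> zb h l = 0. z h l)
           + (\<Sum>(h, l) | (h, l) \<in> hubs I \<times> hubs I \<and> zb h l = 1. 1 - z h l) + \<delta> r \<ge> 1))"

definition optimality_cuts ::
  "('n::finite, 'r) odmts \<Rightarrow> ('n \<Rightarrow> 'n \<Rightarrow> real) \<Rightarrow> ('n \<Rightarrow> 'n \<Rightarrow> real) \<Rightarrow> ('n \<Rightarrow> 'n \<Rightarrow> real)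
     \<Rightarrow> ('r \<Rightarrow> real) \<Rightarrow> bool" where
  "optimality_cuts I bus shuttle z b \<longleftrightarrow>
     (\<forall>r\<in>trips I. \<forall>u v. (u, v) extreme_point_of dual_polyhedron I bus shuttle r \<longrightarrow>
        b r \<ge> (u $ orig I r - u $ dest I r) - (\<Sum>h\<in>hubs I. \<Sum>l\<in>hubs I. z h l * v $ (h, l)))"

definition E_feasible ::
  "('n::finite, 'r) odmts \<Rightarrow> ('n \<Rightarrow> 'n \<Rightarrow> real) \<Rightarrow> ('n \<Rightarrow> 'n \<Rightarrow> real) \<Rightarrow> ('n \<Rightarrow> 'n \<Rightarrow> real)
     \<Rightarrow> ('r \<Rightarrow> real) \<Rightarrow> ('r \<Rightarrow> real) \<Rightarrow> bool" where
  "E_feasible I bus shuttle z \<delta> b \<longleftrightarrow>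
     leader_feasible I z \<delta> \<and> consistency_cuts I z \<delta> \<and> optimality_cuts I bus shuttle z b"

definition E_optimal ::
  "('n::finite, 'r) odmts \<Rightarrow> ('n \<Rightarrow> 'n \<Rightarrow> real) \<Rightarrow> ('n \<Rightarrow> 'n \<Rightarrow> real) \<Rightarrow> ('n \<Rightarrow> 'n \<Rightarrow> real)
     \<Rightarrow> ('r \<Rightarrow> real) \<Rightarrow> ('r \<Rightarrow> real) \<Rightarrow> bool" where
  "E_optimal I bus shuttle z \<delta> b \<longleftrightarrow>
     E_feasible I bus shuttle z \<delta> b \<and>
     (\<forall>z' \<delta>' b'. E_feasible I bus shuttle z' \<delta>' b' \<longrightarrow> objective I z \<delta> b \<le> objective I z' \<delta>' b')"

subsection \<open>Equivalence\<close>

text \<open>Feasible and optimal solutions correspond, with the same \<open>z\<close> and \<open>\<delta>\<close>. In (E) the value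
  \<open>b r\<close> is only bounded below, so a feasible solution of (E) may cost more than the solution of (B)
  it yields; at optimal solutions the objective values agree.\<close>

definition problems_equivalent ::
  "('n::finite, 'r) odmts \<Rightarrow> ('n \<Rightarrow> 'n \<Rightarrow> real) \<Rightarrow> ('n \<Rightarrow> 'n \<Rightarrow> real) \<Rightarrow> bool" where
  "problems_equivalent I bus shuttle \<longleftrightarrow>
     (\<forall>z \<delta> x y. B_feasible I z \<delta> x y \<longrightarrow>
        E_feasible I bus shuttle z \<delta> (\<lambda>r. route_cost I bus shuttle (x r) (y r))) \<and>
     (\<forall>z \<delta> b. E_feasible I bus shuttle z \<delta> b \<longrightarrow>
        (\<exists>x y. B_feasible I z \<delta> x y \<and> B_objective I bus shuttle z \<delta> x y \<le> objective I z \<delta> b)) \<and>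
     (\<forall>z \<delta> x y. B_optimal I bus shuttle z \<delta> x y \<longrightarrow>
        E_optimal I bus shuttle z \<delta> (\<lambda>r. route_cost I bus shuttle (x r) (y r))) \<and>
     (\<forall>z \<delta> b. E_optimal I bus shuttle z \<delta> b \<longrightarrow>
        (\<exists>x y. B_optimal I bus shuttle z \<delta> x y \<and> B_objective I bus shuttle z \<delta> x y = objective I z \<delta> b))"

end

theory Submission
  imports Defs
begin

text \<open>
  For integral \<open>z\<close> the dual subproblem has an explicit optimal solution: \<open>u\<close> is the length of a shortest
  path to the destination and \<open>v h l\<close> is the amount by which \<open>u\<close> violates the constraint of the
  closed leg \<open>(h, l)\<close>. A simple path from the origin is a binary flow of the same cost, so there is
  no integrality gap. As the dual polyhedron lies in the nonnegative orthant, the optimum is also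
  attained at a vertex; hence the optimality cuts at a design force \<open>b r\<close> to be at least the follower's
  value, and by weak duality they force nothing more. The left-hand side of a consistency cut is the
  Hamming distance between two designs, so that only the cut at \<open>z\<close> itself binds.
\<close>

section \<open>Extreme points attaining a linear maximum\<close>

text \<open>
  The linear form \<open>e\<close> replaces compactness: its minimizers among the maximizers of \<open>c\<close> form a
  compact face.
\<close>

lemma extreme_point_attains_max_inner:
  fixes S :: "'a::euclidean_space set"
  assumes S: "closed S" "convex S" and p: "p \<in> S" and max: "\<And>q. q \<in> S \<Longrightarrow> c \<bullet> q \<le> c \<bullet> p"
    and bdd: "\<And>k. bounded {q \<in> S. e \<bullet> q \<le> k}"
  obtains q where "q extreme_point_of S" "c \<bullet> q = c \<bullet> p"
proof -
  define F where "F = S \<inter> {q. c \<bullet> q = c \<bullet> p}"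
  have F_face: "F face_of S"
    unfolding F_def using S(2) max by (rule face_of_Int_supporting_hyperplane_le)
  have F: "closed F" "convex F" "F \<subseteq> S" "p \<in> F"
    unfolding F_def using S p by (auto intro!: closed_Int closed_hyperplane convex_Int convex_hyperplane)
  have compact: "compact (F \<inter> {q. e \<bullet> q \<le> k})" for k
    unfolding compact_eq_bounded_closed
  proof
    show "bounded (F \<inter> {q. e \<bullet> q \<le> k})"
      using F(3) by (intro bounded_subset[OF bdd[of k]]) auto
  qed (intro closed_Int closed_halfspace_le F(1))
  \<comment> \<open>Cutting \<open>F\<close> at the level of \<open>p\<close> leaves a nonempty
    compact set. Points of \<open>F\<close> beyond the cut have larger \<open>e\<close>-value, so
    the minimum found here is a minimum over all of \<open>F\<close>.\<close>
  have "\<exists>m \<in> F \<inter> {q. e \<bullet> q \<le> e \<bullet> p}. \<forall>q \<in> F \<inter> {q. e \<bullet> q \<le> e \<bullet> p}. e \<bullet> m \<le> e \<bullet> q"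
    by (rule continuous_attains_inf[OF compact]) (use F(4) in \<open>auto intro!: continuous_intros\<close>)
  then obtain m where m: "m \<in> F" "\<And>q. q \<in> F \<Longrightarrow> e \<bullet> m \<le> e \<bullet> q"
    by force
  define G where "G = F \<inter> {q. e \<bullet> q = e \<bullet> m}"
  have G_face: "G face_of F"
    unfolding G_def using F(2) m(2) by (intro face_of_Int_supporting_hyperplane_ge) auto
  have "G = (F \<inter> {q. e \<bullet> q \<le> e \<bullet> m}) \<inter> {q. e \<bullet> q = e \<bullet> m}"
    unfolding G_def by auto
  then have "compact G"
    using compact_Int_closed[OF compact closed_hyperplane] by metis
  moreover have "convex G" "G \<noteq> {}"
    using G_face m(1) by (auto simp: G_def dest: face_of_imp_convex)
  ultimately obtain q where q: "q extreme_point_of G"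
    using extreme_point_exists_convex by blast
  have "q extreme_point_of S"
    using q face_of_trans[OF G_face F_face] by (simp add: extreme_point_of_face)
  moreover have "c \<bullet> q = c \<bullet> p"
    using q unfolding extreme_point_of_def G_def F_def by auto
  ultimately show thesis by (rule that)
qed

text \<open>On the nonnegative orthant the coordinate sum is the l1 norm, which dominates the
  Euclidean norm. This supplies the boundedness hypothesis on \<open>e\<close> when \<open>e\<close>
  is the all-ones form.\<close>

lemma bounded_nonneg_sum_le:
  "bounded {(u :: real^'m, v :: real^'k). (\<forall>i. 0 \<le> u $ i) \<and> (\<forall>j. 0 \<le> v $ j) \<and>
     (\<Sum>i\<in>UNIV. u $ i) + (\<Sum>j\<in>UNIV. v $ j) \<le> k}"
proof (rule boundedI[of _ k], clarify)
  fix u :: "real^'m" and v :: "real^'k"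
  assume nonneg: "\<forall>i. 0 \<le> u $ i" "\<forall>j. 0 \<le> v $ j"
    and le: "(\<Sum>i\<in>UNIV. u $ i) + (\<Sum>j\<in>UNIV. v $ j) \<le> k"
  have "norm (u, v) \<le> norm u + norm v"
    by (rule norm_Pair_le)
  also have "\<dots> \<le> (\<Sum>i\<in>UNIV. \<bar>u $ i\<bar>) + (\<Sum>j\<in>UNIV. \<bar>v $ j\<bar>)"
    by (intro add_mono norm_le_l1_cart)
  finally show "norm (u, v) \<le> k"
    using nonneg le by simp
qed

section \<open>Simple paths\<close>

text \<open>A distinct list traverses no arc twice, so for such lists a set of arcs loses no
  multiplicity and summing a cost over it gives the length of the path.\<close>

definition path_arcs :: "'a list \<Rightarrow> ('a \<times> 'a) set" where
  "path_arcs p = set (zip p (tl p))"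

lemma path_arcs_simps [simp]:
  "path_arcs [] = {}" "path_arcs [i] = {}"
  "path_arcs (i # j # p) = insert (i, j) (path_arcs (j # p))"
  by (simp_all add: path_arcs_def)

lemma finite_path_arcs [simp]: "finite (path_arcs p)"
  by (simp add: path_arcs_def)

lemma path_arcs_subset: "path_arcs p \<subseteq> set p \<times> set p"
  by (induction p rule: induct_list012) auto

lemma path_arcs_suffix: "path_arcs q \<subseteq> path_arcs (p @ q)"
proof (induction p)
  case (Cons i p)
  then show ?case by (cases "p @ q") auto
qed simp

text \<open>A prepended arc \<open>(a, b)\<close> adds 1 at \<open>a\<close> and subtracts 1 at
  \<open>b\<close>, which cancels the unit that the old path emits at its head \<open>b\<close>.
  Distinctness ensures that the arc is new, so indicators add up. For a single node the two
  indicators cancel.\<close>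

lemma path_arcs_net_flow:
  fixes p :: "'a::finite list"
  assumes "p \<noteq> []" "distinct p"
  shows "(\<Sum>j\<in>UNIV. of_bool ((i, j) \<in> path_arcs p) - of_bool ((j, i) \<in> path_arcs p) :: real)
    = of_bool (i = hd p) - of_bool (i = last p)"
  using assms
proof (induction p rule: induct_list012)
  case (3 a b p)
  have new: "(a, j) \<notin> path_arcs (b # p)" "(j, a) \<notin> path_arcs (b # p)" for j
    using 3(4) path_arcs_subset[of "b # p"] by auto
  have insert: "of_bool (q \<in> path_arcs (a # b # p)) = (of_bool (q \<in> path_arcs (b # p)) + of_bool (q = (a, b)) :: real)" for q
    using new by (cases "q = (a, b)") auto
  have "(\<Sum>j\<in>UNIV. of_bool ((i, j) \<in> path_arcs (a # b # p)) - of_bool ((j, i) \<in> path_arcs (a # b # p)) :: real)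
    = (\<Sum>j\<in>UNIV. of_bool ((i, j) \<in> path_arcs (b # p)) - of_bool ((j, i) \<in> path_arcs (b # p)))
        + ((\<Sum>j\<in>UNIV. of_bool ((i, j) = (a, b))) - (\<Sum>j\<in>UNIV. of_bool ((j, i) = (a, b))))"
    by (simp only: insert sum.distrib sum_subtractf)
  also have "(\<Sum>j\<in>UNIV. of_bool ((i, j) = (a, b)) :: real) = of_bool (i = a)"
    by (cases "i = a") (simp_all add: of_bool_def)
  also have "(\<Sum>j\<in>UNIV. of_bool ((j, i) = (a, b)) :: real) = of_bool (i = b)"
    by (cases "i = b") (simp_all add: of_bool_def)
  also have "(\<Sum>j\<in>UNIV. of_bool ((i, j) \<in> path_arcs (b # p)) - of_bool ((j, i) \<in> path_arcs (b # p)) :: real)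
    = of_bool (i = b) - of_bool (i = last (b # p))"
    using 3(2,4) by simp
  finally show ?case by simp
qed simp_all

section \<open>Shortest-path distance to a fixed target\<close>

definition simple_paths :: "('a \<times> 'a) set \<Rightarrow> 'a \<Rightarrow> 'a \<Rightarrow> 'a list set" where
  "simple_paths E t i = {p. p \<noteq> [] \<and> distinct p \<and> path_arcs p \<subseteq> E \<and> hd p = i \<and> last p = t}"

lemma finite_simple_paths: "finite (simple_paths E t (i :: 'a::finite))"
proof (rule finite_subset)
  show "simple_paths E t i \<subseteq> {p. set p \<subseteq> UNIV \<and> length p \<le> CARD('a)}"
    by (auto simp: simple_paths_def distinct_card[symmetric] simp del: distinct_card intro!: card_mono)
qed (intro finite_lists_length_le finite)

text \<open>The distance from \<open>i\<close> to \<open>t\<close> in the digraph \<open>E\<close>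
  with arc lengths \<open>w\<close>. The default 0 at nodes that cannot reach \<open>t\<close> keeps
  the potential nonnegative, but arc inequalities may fail at such nodes.\<close>

definition potential :: "('a \<times> 'a) set \<Rightarrow> ('a \<times> 'a \<Rightarrow> real) \<Rightarrow> 'a \<Rightarrow> 'a \<Rightarrow> real" where
  "potential E w t i =
     (if simple_paths E t i = {} then 0 else Min ((\<lambda>p. sum w (path_arcs p)) ` simple_paths E t i))"

lemma potential_le:
  fixes i :: "'a::finite"
  assumes "p \<in> simple_paths E t i"
  shows "potential E w t i \<le> sum w (path_arcs p)"
  using assms by (auto simp: potential_def finite_simple_paths)

lemma potential_attained:
  fixes i :: "'a::finite"
  assumes "simple_paths E t i \<noteq> {}"
  obtains p where "p \<in> simple_paths E t i" "potential E w t i = sum w (path_arcs p)"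
proof -
  have "potential E w t i \<in> (\<lambda>p. sum w (path_arcs p)) ` simple_paths E t i"
    using assms by (auto simp: potential_def finite_simple_paths intro!: Min_in)
  then show thesis using that by auto
qed

lemma potential_nonneg:
  fixes i :: "'a::finite"
  assumes "\<And>a. a \<in> E \<Longrightarrow> 0 \<le> w a"
  shows "0 \<le> potential E w t i"
proof (cases "simple_paths E t i = {}")
  case False
  then obtain p where p: "p \<in> simple_paths E t i" "potential E w t i = sum w (path_arcs p)"
    by (rule potential_attained)
  then show ?thesis
    using assms by (auto simp: simple_paths_def intro!: sum_nonneg)
qed (simp add: potential_def)

lemma potential_target:
  fixes t :: "'a::finite"
  assumes "\<And>a. a \<in> E \<Longrightarrow> 0 \<le> w a"
  shows "potential E w t t = 0"
proof -
  have "[t] \<in> simple_paths E t t"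
    by (simp add: simple_paths_def)
  from potential_le[OF this, of w] have "potential E w t t \<le> 0"
    by simp
  with potential_nonneg[of E w t t, OF assms] show ?thesis
    by simp
qed

text \<open>Take a shortest path from \<open>j\<close>. If it avoids \<open>i\<close>, prepend the
  arc; if it visits \<open>i\<close>, its part from \<open>i\<close> on is already a simple path
  and, lengths being nonnegative, no longer. The assumption \<open>reach\<close> excludes the
  default value at \<open>j\<close>.\<close>

lemma potential_arc:
  fixes i :: "'a::finite"
  assumes arc: "(i, j) \<in> E" and w: "\<And>a. a \<in> E \<Longrightarrow> 0 \<le> w a" and reach: "simple_paths E t j \<noteq> {}"
  shows "potential E w t i \<le> w (i, j) + potential E w t j"
proof -
  obtain p where p: "p \<in> simple_paths E t j" "potential E w t j = sum w (path_arcs p)"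
    using reach by (rule potential_attained)
  then obtain p' where p': "p = j # p'"
    unfolding simple_paths_def by (cases p) auto
  show ?thesis
  proof (cases "i \<in> set p")
    case False
    then have "i # p \<in> simple_paths E t i"
      using p(1) arc by (auto simp: simple_paths_def p')
    then have "potential E w t i \<le> sum w (path_arcs (i # p))"
      by (rule potential_le)
    also have "(i, j) \<notin> path_arcs p"
      using False path_arcs_subset[of p] by auto
    then have "sum w (path_arcs (i # p)) = w (i, j) + sum w (path_arcs p)"
      by (simp add: p')
    finally show ?thesis using p(2) by simp
  next
    case True
    then obtain q s where s: "p = q @ i # s"
      by (auto simp: in_set_conv_decomp)
    have sub: "path_arcs (i # s) \<subseteq> path_arcs p"
      unfolding s by (rule path_arcs_suffix)
    have "i # s \<in> simple_paths E t i"
      using p(1) sub by (auto simp: simple_paths_def s)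
    then have "potential E w t i \<le> sum w (path_arcs (i # s))"
      by (rule potential_le)
    also have "\<dots> \<le> sum w (path_arcs p)"
      using p(1) sub w by (intro sum_mono2) (auto simp: simple_paths_def)
    finally show ?thesis using p(2) w[OF arc] by simp
  qed
qed

section \<open>Duality for the follower problem\<close>

text \<open>Weight the flow balance at each node by \<open>u\<close> and sum: the result regroups
  into potential differences along the arcs used, which the dual constraints bound. Shuttles outside
  \<open>direct_arcs\<close> have no dual constraint, hence the assumption
  \<open>direct\<close>.\<close>

lemma weak_duality:
  fixes I :: "('n::finite, 'r) odmts"
  assumes feas: "follower_feasible I r z x y" and ends: "orig I r \<noteq> dest I r"
    and direct: "\<And>i j. (i, j) \<notin> direct_arcs I r \<Longrightarrow> y i j = 0"
    and dual: "(u, v) \<in> dual_polyhedron I bus shuttle r"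
  shows "u $ orig I r - u $ dest I r - (\<Sum>h\<in>hubs I. \<Sum>l\<in>hubs I. z h l * v $ (h, l))
    \<le> route_cost I bus shuttle x y"
proof -
  let ?H = "hubs I"
  have flow: "(if i \<in> ?H then \<Sum>h\<in>?H. x i h - x h i else 0) + (\<Sum>j\<in>UNIV. y i j - y j i)
            = (if i = orig I r then 1 else if i = dest I r then -1 else 0)" for i
    using feas unfolding follower_feasible_def by blast
  \<comment> \<open>Summation by parts, needed once over the hubs for \<open>x\<close> and once over
    all nodes for \<open>y\<close>.\<close>
  have telescope: "(\<Sum>i\<in>A. u $ i * (\<Sum>j\<in>A. f i j - f j i)) = (\<Sum>i\<in>A. \<Sum>j\<in>A. (u $ i - u $ j) * f i j)"
    for A and f :: "'n \<Rightarrow> 'n \<Rightarrow> real"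
  proof -
    have "(\<Sum>i\<in>A. u $ i * (\<Sum>j\<in>A. f i j - f j i))
        = (\<Sum>i\<in>A. \<Sum>j\<in>A. u $ i * f i j) - (\<Sum>i\<in>A. \<Sum>j\<in>A. u $ i * f j i)"
      by (simp add: sum_distrib_left right_diff_distrib sum_subtractf)
    also have "(\<Sum>i\<in>A. \<Sum>j\<in>A. u $ i * f j i) = (\<Sum>i\<in>A. \<Sum>j\<in>A. u $ j * f i j)"
      by (rule sum.swap)
    finally show ?thesis
      by (simp add: left_diff_distrib sum_subtractf)
  qed
  have "u $ orig I r - u $ dest I r
      = (\<Sum>i\<in>UNIV. (if i = orig I r then u $ i else 0) - (if i = dest I r then u $ i else 0))"
    by (simp only: sum_subtractf sum.delta finite UNIV_I if_True)
  also have "\<dots> = (\<Sum>i\<in>UNIV. u $ i * (if i = orig I r then 1 else if i = dest I r then -1 else 0))"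
    using ends by (intro sum.cong refl) auto
  also have "\<dots> = (\<Sum>i\<in>UNIV. (if i \<in> ?H then u $ i * (\<Sum>h\<in>?H. x i h - x h i) else 0)
      + u $ i * (\<Sum>j\<in>UNIV. y i j - y j i))"
    unfolding flow[symmetric] by (intro sum.cong refl) (simp add: distrib_left)
  also have "\<dots> = (\<Sum>i\<in>?H. u $ i * (\<Sum>h\<in>?H. x i h - x h i)) + (\<Sum>i\<in>UNIV. u $ i * (\<Sum>j\<in>UNIV. y i j - y j i))"
    by (simp add: sum.distrib sum.If_cases)
  also have "\<dots> = (\<Sum>h\<in>?H. \<Sum>l\<in>?H. (u $ h - u $ l) * x h l) + (\<Sum>i\<in>UNIV. \<Sum>j\<in>UNIV. (u $ i - u $ j) * y i j)"
    unfolding telescope ..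
  also have "\<dots> \<le> (\<Sum>h\<in>?H. \<Sum>l\<in>?H. bus h l * x h l + z h l * v $ (h, l)) + (\<Sum>i\<in>UNIV. \<Sum>j\<in>UNIV. shuttle i j * y i j)"
  proof (intro add_mono sum_mono)
    fix h l assume hl: "h \<in> ?H" "l \<in> ?H"
    then have x: "x h l = 0 \<or> x h l = 1" "x h l \<le> z h l"
      using feas unfolding follower_feasible_def by auto
    have d: "u $ h - u $ l - v $ (h, l) \<le> bus h l" "0 \<le> v $ (h, l)"
      using dual hl unfolding dual_polyhedron_def by auto
    have "(u $ h - u $ l) * x h l \<le> (bus h l + v $ (h, l)) * x h l"
      using x(1) d(1) by auto
    \<comment> \<open>Here the capacity \<open>x h l \<le> z h l\<close> is paid for by its
      multiplier \<open>v $ (h, l) \<ge> 0\<close>.\<close>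
    also have "\<dots> \<le> bus h l * x h l + z h l * v $ (h, l)"
      using mult_right_mono[OF x(2) d(2)] by (simp add: algebra_simps)
    finally show "(u $ h - u $ l) * x h l \<le> bus h l * x h l + z h l * v $ (h, l)" .
  next
    fix i j
    have "y i j = 0 \<or> y i j = 1"
      using feas unfolding follower_feasible_def by auto
    moreover have "(i, j) \<in> direct_arcs I r \<Longrightarrow> u $ i - u $ j \<le> shuttle i j"
      using dual unfolding dual_polyhedron_def by auto
    ultimately show "(u $ i - u $ j) * y i j \<le> shuttle i j * y i j"
      using direct[of i j] by (cases "(i, j) \<in> direct_arcs I r") auto
  qed
  finally show ?thesis
    unfolding route_cost_def by (simp add: sum.distrib)
qed

text \<open>Costs are arbitrary nonnegative functions, so that the original costs, the scaled costs
  and zero costs are all covered. A feasible route and a dual vertex of equal value certify each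
  other.\<close>

lemma strong_duality_extreme_point:
  fixes I :: "('n::finite, 'r) odmts"
  assumes design: "is_design I z" and ends: "orig I r \<noteq> dest I r"
    and arcs: "direct_arcs I r \<subseteq> shuttles I r"
    and nonneg: "\<And>i j. 0 \<le> bus i j" "\<And>i j. 0 \<le> shuttle i j"
  obtains x y u v where "follower_feasible I r z x y"
    "(u, v) extreme_point_of dual_polyhedron I bus shuttle r"
    "route_cost I bus shuttle x y
       = u $ orig I r - u $ dest I r - (\<Sum>h\<in>hubs I. \<Sum>l\<in>hubs I. z h l * v $ (h, l))"
proof -
  let ?H = "hubs I" and ?o = "orig I r" and ?d = "dest I r" and ?A = "direct_arcs I r"
    and ?D = "dual_polyhedron I bus shuttle r"
  define B where "B = {(h, l). h \<in> ?H \<and> l \<in> ?H \<and> z h l = 1}"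
  \<comment> \<open>On an arc served by both a bus and a shuttle, the path takes the cheaper one.\<close>
  define by_bus where
    "by_bus a \<longleftrightarrow> a \<in> B \<and> (a \<in> ?A \<longrightarrow> case_prod bus a \<le> case_prod shuttle a)" for a
  define w where "w a = (if by_bus a then case_prod bus a else case_prod shuttle a)" for a
  define E where "E = B \<union> ?A"
  define \<pi> where "\<pi> = potential E w ?d"
  have w_nonneg: "0 \<le> w a" for a
    using nonneg by (auto simp: w_def split: prod.splits)
  have w_bus: "w (h, l) \<le> bus h l" if "(h, l) \<in> B" for h l
    using that by (auto simp: w_def by_bus_def)
  have w_shuttle: "w (i, j) \<le> shuttle i j" if "(i, j) \<in> ?A" for i j
    using that by (auto simp: w_def by_bus_def)
  \<comment> \<open>Every hub, like the origin, has a direct shuttle to the destination. All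
    endpoints of arcs in \<open>E\<close> are therefore covered, and the default of
    \<open>potential\<close> never occurs on them.\<close>
  have reach: "simple_paths E ?d i \<noteq> {}" if "i \<in> insert ?o (insert ?d ?H)" for i
  proof (cases "i = ?d")
    case True
    then have "[?d] \<in> simple_paths E ?d i"
      by (simp add: simple_paths_def)
    then show ?thesis by blast
  next
    case False
    have "(i, ?d) \<in> E"
      using that False by (auto simp: E_def direct_arcs_def)
    then have "[i, ?d] \<in> simple_paths E ?d i"
      using False by (simp add: simple_paths_def)
    then show ?thesis by blast
  qed
  have arc: "\<pi> i \<le> w (i, j) + \<pi> j" if "(i, j) \<in> E" for i j
    unfolding \<pi>_def
  proof (rule potential_arc[OF that w_nonneg reach])
    show "j \<in> insert ?o (insert ?d ?H)"
      using that by (auto simp: E_def B_def direct_arcs_def)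
  qed

  obtain p where p: "p \<in> simple_paths E ?d ?o" "\<pi> ?o = sum w (path_arcs p)"
    unfolding \<pi>_def using potential_attained[OF reach, of ?o] by blast
  define P where "P = path_arcs p"
  \<comment> \<open>Each arc of the path is ridden in exactly one mode, so \<open>x + y\<close> is
    the indicator of \<open>P\<close> and the flow balance reduces to that of the path.\<close>
  define x y :: "'n \<Rightarrow> 'n \<Rightarrow> real"
    where "x i j = of_bool ((i, j) \<in> P \<and> by_bus (i, j))"
      and "y i j = of_bool ((i, j) \<in> P \<and> \<not> by_bus (i, j))" for i j
  have P: "P \<subseteq> E"
    using p(1) by (simp add: simple_paths_def P_def)
  have direct: "y i j = 0" if "(i, j) \<notin> ?A" for i j
    using that P by (auto simp: y_def E_def by_bus_def)
  have x_hub: "x i j = 0" if "i \<notin> ?H \<or> j \<notin> ?H" for i j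
    using that by (auto simp: x_def by_bus_def B_def)
  have x_le: "x h l \<le> z h l" if "h \<in> ?H" "l \<in> ?H" for h l
  proof -
    have "z h l = 0 \<or> z h l = 1"
      using design that by (auto simp: is_design_def)
    then show ?thesis
      using that by (auto simp: x_def by_bus_def B_def)
  qed
  have net: "(if i \<in> ?H then \<Sum>h\<in>?H. x i h - x h i else 0) + (\<Sum>j\<in>UNIV. y i j - y j i)
      = (if i = ?o then 1 else if i = ?d then -1 else 0)" for i
  proof -
    \<comment> \<open>Bus arcs only join hubs, so the sums over hubs extend to all nodes, also at a
      node that is no hub.\<close>
    have "(if i \<in> ?H then \<Sum>h\<in>?H. x i h - x h i else 0) = (\<Sum>j\<in>UNIV. x i j - x j i)"
    proof (cases "i \<in> ?H")
      case True
      then show ?thesis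
        using x_hub by (auto intro!: sum.mono_neutral_left)
    qed (simp add: x_hub)
    then have "(if i \<in> ?H then \<Sum>h\<in>?H. x i h - x h i else 0) + (\<Sum>j\<in>UNIV. y i j - y j i)
      = (\<Sum>j\<in>UNIV. of_bool ((i, j) \<in> P) - of_bool ((j, i) \<in> P))"
      unfolding x_def y_def by (simp add: sum.distrib[symmetric] of_bool_def) (auto intro!: sum.cong)
    also have "\<dots> = of_bool (i = ?o) - of_bool (i = ?d)"
      using p(1) path_arcs_net_flow[of p i] by (auto simp: simple_paths_def P_def)
    finally show ?thesis
      using ends by auto
  qed
  have feas: "follower_feasible I r z x y"
    unfolding follower_feasible_def
  proof (intro conjI allI ballI impI)
    show "y i j = 0" if "(i, j) \<notin> shuttles I r" for i j
      using that arcs direct by blast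
  qed (auto simp: x_le net, auto simp: x_def y_def)
  have cost: "route_cost I bus shuttle x y = \<pi> ?o"
  proof -
    have "(\<Sum>h\<in>?H. \<Sum>l\<in>?H. bus h l * x h l) = (\<Sum>h\<in>UNIV. \<Sum>l\<in>?H. bus h l * x h l)"
      by (rule sum.mono_neutral_left) (auto simp: x_hub)
    also have "\<dots> = (\<Sum>h\<in>UNIV. \<Sum>l\<in>UNIV. bus h l * x h l)"
      by (intro sum.cong refl sum.mono_neutral_left) (auto simp: x_hub)
    finally have "route_cost I bus shuttle x y
        = (\<Sum>i\<in>UNIV. \<Sum>j\<in>UNIV. bus i j * x i j + shuttle i j * y i j)"
      by (simp add: route_cost_def sum.distrib)
    also have "\<dots> = (\<Sum>i\<in>UNIV. \<Sum>j\<in>UNIV. if (i, j) \<in> P then w (i, j) else 0)"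
      by (intro sum.cong refl) (auto simp: x_def y_def w_def)
    also have "\<dots> = (\<Sum>a\<in>UNIV. if a \<in> P then w a else 0)"
      by (simp add: sum.cartesian_product case_prod_eta)
    also have "\<dots> = sum w P"
      by (simp add: sum.If_cases)
    finally show ?thesis
      using p(2) by (simp add: P_def)
  qed

  define u :: "real^'n" where "u = (\<chi> i. \<pi> i)"
  define v :: "real^('n \<times> 'n)" where
    "v = (\<chi> a. if a \<in> ?H \<times> ?H then max 0 (\<pi> (fst a) - \<pi> (snd a) - case_prod bus a) else 0)"
  have dual: "(u, v) \<in> ?D"
    using arc w_shuttle
    by (fastforce simp: dual_polyhedron_def u_def v_def E_def \<pi>_def intro: potential_nonneg w_nonneg order_trans)
  \<comment> \<open>Complementary slackness: on an open leg the distance inequality makes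
    \<open>v\<close> vanish, on a closed leg \<open>z\<close> does.\<close>
  have zv: "(\<Sum>h\<in>?H. \<Sum>l\<in>?H. z h l * v $ (h, l)) = 0"
  proof (intro sum.neutral ballI)
    fix h l assume hl: "h \<in> ?H" "l \<in> ?H"
    show "z h l * v $ (h, l) = 0"
    proof (cases "z h l = 1")
      case True
      then have "(h, l) \<in> B"
        using hl by (simp add: B_def)
      then have "\<pi> h - \<pi> l \<le> bus h l"
        using arc[of h l] w_bus[of h l] by (simp add: E_def)
      then show ?thesis using hl by (simp add: v_def)
    next
      case False
      then show ?thesis using hl design by (auto simp: is_design_def)
    qed
  qed
  have target: "\<pi> ?d = 0"
    unfolding \<pi>_def by (rule potential_target) (rule w_nonneg)

  \<comment> \<open>The dual objective at \<open>z\<close> as an inner product, the form required by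
    \<open>extreme_point_attains_max_inner\<close>.\<close>
  define c :: "(real^'n) \<times> (real^('n \<times> 'n))" where
    "c = (axis ?o 1 - axis ?d 1, \<chi> a. if a \<in> ?H \<times> ?H then - case_prod z a else 0)"
  have c: "c \<bullet> (u', v') = u' $ ?o - u' $ ?d - (\<Sum>h\<in>?H. \<Sum>l\<in>?H. z h l * v' $ (h, l))" for u' v'
  proof -
    have "(\<chi> a. if a \<in> ?H \<times> ?H then - case_prod z a else 0) \<bullet> v'
        = (\<Sum>a\<in>UNIV. if a \<in> ?H \<times> ?H then - (case_prod z a * v' $ a) else 0)"
      unfolding inner_vec_def by (intro sum.cong) auto
    also have "\<dots> = - (\<Sum>a\<in>?H \<times> ?H. case_prod z a * v' $ a)"
      by (simp only: sum.inter_restrict[symmetric] finite Int_UNIV_left sum_negf)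
    finally show ?thesis
      by (simp add: c_def inner_prod_def inner_diff_left inner_axis' sum.cartesian_product case_prod_unfold)
  qed
  define e :: "(real^'n) \<times> (real^('n \<times> 'n))" where "e = (\<chi> i. 1, \<chi> a. 1)"
  have e: "e \<bullet> (u', v') = (\<Sum>i\<in>UNIV. u' $ i) + (\<Sum>a\<in>UNIV. v' $ a)" for u' v'
    by (simp add: e_def inner_prod_def inner_vec_def)
  have val: "c \<bullet> (u, v) = \<pi> ?o"
    unfolding c zv by (simp add: u_def target)
  have D_eq: "?D = (\<Inter>h\<in>?H. \<Inter>l\<in>?H. {q. fst q $ h - fst q $ l - snd q $ (h, l) \<le> bus h l})
      \<inter> (\<Inter>(i, j)\<in>?A. {q. fst q $ i - fst q $ j \<le> shuttle i j})
      \<inter> (\<Inter>i. {q. 0 \<le> fst q $ i}) \<inter> (\<Inter>h\<in>?H. \<Inter>l\<in>?H. {q. 0 \<le> snd q $ (h, l)})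
      \<inter> (\<Inter>h. \<Inter>l\<in>{l. (h, l) \<notin> ?H \<times> ?H}. {q. snd q $ (h, l) = 0})"
    by (auto simp: dual_polyhedron_def)
  have "closed ?D"
    unfolding D_eq
    by (intro closed_Int closed_INT ballI)
      (auto intro!: closed_Collect_le closed_Collect_eq continuous_intros)
  moreover have "convex ?D"
    unfolding convex_alt dual_polyhedron_def
  proof (clarsimp, intro conjI ballI)
    fix u1 u2 :: "real^'n" and v1 v2 :: "real^('n \<times> 'n)" and t :: real
    assume t: "0 \<le> t" "t \<le> 1"
    have combine: "(1 - t) * a + t * b \<le> k" if "a \<le> k" "b \<le> k" for a b k :: real
      using convex_bound_le[OF that, of "1 - t" t] t by simp
    {
      fix h l assume hl: "h \<in> ?H" "l \<in> ?H"
        and "\<forall>h\<in>?H. \<forall>l\<in>?H. u1 $ h - u1 $ l - v1 $ (h, l) \<le> bus h l"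
          "\<forall>h\<in>?H. \<forall>l\<in>?H. u2 $ h - u2 $ l - v2 $ (h, l) \<le> bus h l"
      then show "(1 - t) * u1 $ h + t * u2 $ h - ((1 - t) * u1 $ l + t * u2 $ l)
          - ((1 - t) * v1 $ (h, l) + t * v2 $ (h, l)) \<le> bus h l"
        using combine[of "u1 $ h - u1 $ l - v1 $ (h, l)" "bus h l" "u2 $ h - u2 $ l - v2 $ (h, l)"]
        by (simp add: algebra_simps)
    next
      fix a assume "a \<in> ?A"
        and "\<forall>a\<in>?A. case a of (i, j) \<Rightarrow> u1 $ i - u1 $ j \<le> shuttle i j"
          "\<forall>a\<in>?A. case a of (i, j) \<Rightarrow> u2 $ i - u2 $ j \<le> shuttle i j"
      then show "case a of (i, j) \<Rightarrow> (1 - t) * u1 $ i + t * u2 $ i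
          - ((1 - t) * u1 $ j + t * u2 $ j) \<le> shuttle i j"
        using combine[of "u1 $ fst a - u1 $ snd a" "case_prod shuttle a" "u2 $ fst a - u2 $ snd a"]
        by (force simp: algebra_simps)
    }
  qed
  moreover note dual
  \<comment> \<open>The path uses only shuttles in \<open>direct_arcs\<close>, so weak duality
    bounds every dual point by its cost, which \<open>(u, v)\<close> attains.\<close>
  moreover have "c \<bullet> q \<le> c \<bullet> (u, v)" if "q \<in> ?D" for q
  proof -
    obtain u' v' where q: "q = (u', v')" by (cases q)
    then show ?thesis
      using weak_duality[OF feas ends direct, of u' v' bus shuttle] that
      by (simp add: q c[of u' v'] val cost)
  qed
  moreover have "bounded {q \<in> ?D. e \<bullet> q \<le> k}" for k
    by (rule bounded_subset[OF bounded_nonneg_sum_le[of k]])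
      (force simp: dual_polyhedron_def e)
  ultimately obtain q where "q extreme_point_of ?D" "c \<bullet> q = c \<bullet> (u, v)"
    by (rule extreme_point_attains_max_inner)
  then have "(fst q, snd q) extreme_point_of ?D"
    "route_cost I bus shuttle x y = c \<bullet> (fst q, snd q)"
    by (simp_all add: cost val)
  with feas show thesis
    unfolding c by (rule that)
qed

section \<open>Follower solutions\<close>

lemma route_cost_cong:
  assumes "\<And>h l. h \<in> hubs I \<Longrightarrow> l \<in> hubs I \<Longrightarrow> x h l = x' h l"
  shows "route_cost I bus shuttle x y = route_cost I bus shuttle x' y"
  using assms by (simp add: route_cost_def)

lemma follower_feasible_cong:
  assumes "\<And>h l. h \<in> hubs I \<Longrightarrow> l \<in> hubs I \<Longrightarrow> x h l = x' h l"
    and "\<And>h l. h \<in> hubs I \<Longrightarrow> l \<in> hubs I \<Longrightarrow> z h l = z' h l"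
  shows "follower_feasible I r z x y = follower_feasible I r z' x' y"
  using assms by (simp add: follower_feasible_def cong: if_cong)

lemma follower_solution_cong:
  assumes "\<And>h l. h \<in> hubs I \<Longrightarrow> l \<in> hubs I \<Longrightarrow> z h l = z' h l"
  shows "follower_solution I r z x y = follower_solution I r z' x y"
proof -
  have "follower_feasible I r z x y = follower_feasible I r z' x y" for x y
    using assms by (intro follower_feasible_cong) auto
  then show ?thesis
    by (simp add: follower_solution_def)
qed

text \<open>Feasibility leaves \<open>x\<close> free off the hubs. Fixing it to zero there makes
  both components 0/1 matrices, of which there are finitely many.\<close>

lemma finite_follower_feasible_hub_supported:
  fixes I :: "('n::finite, 'r) odmts"
  shows "finite {(x, y). follower_feasible I r z x y \<and> (\<forall>h l. (h, l) \<notin> hubs I \<times> hubs I \<longrightarrow> x h l = 0)}"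
proof (rule finite_subset)
  let ?R = "range (\<lambda>S i j. of_bool ((i, j) \<in> S)) :: ('n \<Rightarrow> 'n \<Rightarrow> real) set"
  show "finite (?R \<times> ?R)" by simp
  have in_R: "f \<in> ?R" if "\<And>i j. f i j \<in> {0, 1}" for f :: "'n \<Rightarrow> 'n \<Rightarrow> real"
    using that by (intro image_eqI[of _ _ "{(i, j). f i j = 1}"]) (fastforce simp: fun_eq_iff)+
  show "{(x, y). follower_feasible I r z x y \<and> (\<forall>h l. (h, l) \<notin> hubs I \<times> hubs I \<longrightarrow> x h l = 0)} \<subseteq> ?R \<times> ?R"
  proof (rule subsetI, elim CollectE case_prodE conjE)
    fix p x y
    assume p: "p = (x, y)" and feas: "follower_feasible I r z x y"
      and supp: "\<forall>h l. (h, l) \<notin> hubs I \<times> hubs I \<longrightarrow> x h l = 0"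
    have "x i j \<in> {0, 1}" for i j
      using feas supp by (cases "(i, j) \<in> hubs I \<times> hubs I") (auto simp: follower_feasible_def)
    moreover have "y i j \<in> {0, 1}" for i j
      using feas by (simp add: follower_feasible_def)
    ultimately show "p \<in> ?R \<times> ?R"
      unfolding p by (intro SigmaI in_R)
  qed
qed

text \<open>Zeroing \<open>x\<close> off the hubs changes neither feasibility nor costs, so the
  values stay finite in number even where the set of feasible functions is infinite. Minima are
  therefore taken over values.\<close>

lemma finite_route_values:
  fixes I :: "('n::finite, 'r) odmts"
  shows "finite {(ride_cost I x y, inconvenience I x y) | x y. follower_feasible I r z x y}"
proof (rule finite_subset)
  let ?V = "\<lambda>(x, y). (ride_cost I x y, inconvenience I x y)"
    and ?S = "{(x, y). follower_feasible I r z x y \<and> (\<forall>h l. (h, l) \<notin> hubs I \<times> hubs I \<longrightarrow> x h l = 0)}"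
  show "finite (?V ` ?S)"
    by (intro finite_imageI finite_follower_feasible_hub_supported)
  show "{(ride_cost I x y, inconvenience I x y) | x y. follower_feasible I r z x y} \<subseteq> ?V ` ?S"
  proof clarify
    fix x y assume feas: "follower_feasible I r z x y"
    define x' where "x' h l = (if (h, l) \<in> hubs I \<times> hubs I then x h l else 0)" for h l
    have eq: "x h l = x' h l" if "h \<in> hubs I" "l \<in> hubs I" for h l
      using that by (simp add: x'_def)
    have "follower_feasible I r z x' y"
      using feas follower_feasible_cong[of I x x' z z r y, OF eq refl] by blast
    then have "(x', y) \<in> ?S"
      by (simp add: x'_def)
    moreover have "route_cost I bus shuttle x y = route_cost I bus shuttle x' y" for bus shuttle
      by (rule route_cost_cong[OF eq])
    then have "(ride_cost I x y, inconvenience I x y) = ?V (x', y)"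
      by simp
    ultimately show "(ride_cost I x y, inconvenience I x y) \<in> ?V ` ?S"
      by (rule rev_image_eqI)
  qed
qed

section \<open>Existence and well-defined value of the lexicographic minimum\<close>

lemma follower_feasible_exists:
  fixes I :: "('n::finite, 'r) odmts"
  assumes I: "odmts_instance I" and r: "r \<in> trips I" and z: "is_design I z"
  obtains x y where "follower_feasible I r z x y"
proof -
  have ends: "orig I r \<noteq> dest I r" and arcs: "direct_arcs I r \<subseteq> shuttles I r"
    using I r by (auto simp: odmts_instance_def)
  show thesis
    \<comment> \<open>Zero costs meet the sign conditions; only the feasible route is kept.\<close>
    by (rule strong_duality_extreme_point[OF z ends arcs, of "\<lambda>_ _. 0" "\<lambda>_ _. 0"]) (auto intro: that)
qed

lemma finite_lex_min:
  assumes "finite V" "V \<noteq> {}"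
  shows "\<exists>p\<in>V. \<forall>q\<in>V. lex_le p q"
proof -
  define m where "m = Min (fst ` V)"
  define W where "W = {q \<in> V. fst q = m}"
  have "m \<in> fst ` V"
    unfolding m_def using assms by (intro Min_in) auto
  then have "W \<noteq> {}" "finite W"
    using assms by (auto simp: W_def)
  then obtain p where p: "p \<in> W" "\<And>q. q \<in> W \<Longrightarrow> snd p \<le> snd q"
    using arg_min_if_finite(1)[of W snd] arg_min_least[of W _ snd] by blast
  have "lex_le p q" if "q \<in> V" for q
  proof -
    have "m \<le> fst q"
      unfolding m_def using assms that by simp
    then show ?thesis
      using p that by (auto simp: lex_le_def W_def)
  qed
  moreover have "p \<in> V"
    using p(1) by (simp add: W_def)
  ultimately show ?thesis
    by blast
qed

lemma follower_solution_exists: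
  fixes I :: "('n::finite, 'r) odmts"
  assumes "odmts_instance I" "r \<in> trips I" "is_design I z"
  obtains x y where "follower_solution I r z x y"
proof -
  let ?V = "{(ride_cost I x y, inconvenience I x y) | x y. follower_feasible I r z x y}"
  obtain x y where "follower_feasible I r z x y"
    by (rule follower_feasible_exists[OF assms])
  then have "?V \<noteq> {}"
    by blast
  then obtain p where p: "p \<in> ?V" and min: "\<forall>q\<in>?V. lex_le p q"
    using finite_lex_min[OF finite_route_values[of I r z]] by meson
  from p obtain x y where feas: "follower_feasible I r z x y"
    and p_eq: "p = (ride_cost I x y, inconvenience I x y)"
    by (elim CollectE exE conjE)
  have "follower_solution I r z x y"
    unfolding follower_solution_def p_eq[symmetric]
  proof (intro conjI allI impI min[rule_format] CollectI exI)
    show "follower_feasible I r z x y"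
      by (rule feas)
  qed (rule refl, assumption)
  then show thesis by (rule that)
qed

lemma follower_solution_unique_values:
  assumes "follower_solution I r z x y" "follower_solution I r z x' y'"
  shows "ride_cost I x y = ride_cost I x' y'" "inconvenience I x y = inconvenience I x' y'"
  using assms unfolding follower_solution_def lex_le_def by force+

text \<open>The pair chosen by \<open>SOME\<close> is a solution because one is given, and
  lexicographic minimality forces equal inconvenience on any two solutions.\<close>

lemma design_choice_eq_choice:
  assumes "follower_solution I r z x y"
  shows "design_choice I r z = choice I r x y"
proof -
  obtain x' y' where s: "(SOME (x, y). follower_solution I r z x y) = (x', y')"
    by fastforce
  have "follower_solution I r z x' y'"
    using someI[of "\<lambda>(x, y). follower_solution I r z x y" "(x, y)"] assms by (simp add: s)
  then show ?thesis
    using follower_solution_unique_values(2)[OF assms] by (simp add: design_choice_def s choice_def)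
qed

section \<open>Costs minimized by the follower solutions\<close>

text \<open>The property shared by the original and the scaled cost pair; it lets one equivalence
  proof serve both.\<close>

definition follower_minimizes ::
  "('n::finite, 'r) odmts \<Rightarrow> ('n \<Rightarrow> 'n \<Rightarrow> real) \<Rightarrow> ('n \<Rightarrow> 'n \<Rightarrow> real) \<Rightarrow> bool" where
  "follower_minimizes I bus shuttle \<longleftrightarrow>
     (\<forall>r\<in>trips I. \<forall>z x y x' y'. is_design I z \<longrightarrow> follower_solution I r z x y \<longrightarrow>
        follower_feasible I r z x' y' \<longrightarrow> route_cost I bus shuttle x y \<le> route_cost I bus shuttle x' y')"

lemma follower_minimizes_ride_cost: "follower_minimizes I (tau I) (gamma I)"
  unfolding follower_minimizes_def follower_solution_def lex_le_def by force

lemma route_cost_hat: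
  "route_cost I (tau_hat I M) (gamma_hat I M) x y = M * ride_cost I x y + inconvenience I x y"
  unfolding route_cost_def tau_hat_def gamma_hat_def
  by (simp add: algebra_simps sum.distrib sum_distrib_left)

text \<open>\<open>suitably_large\<close> says that minimizers of \<open>M b + f\<close> are
  lexicographic solutions; the converse is needed. By finiteness some minimizer exists, it is a
  solution, and all solutions share its values of \<open>b\<close> and \<open>f\<close>.\<close>

lemma follower_minimizes_hat:
  fixes I :: "('n::finite, 'r) odmts"
  assumes I: "odmts_instance I" and M: "suitably_large I M"
  shows "follower_minimizes I (tau_hat I M) (gamma_hat I M)"
  unfolding follower_minimizes_def
proof (intro ballI allI impI)
  fix r z x y x' y'
  assume r: "r \<in> trips I" and z: "is_design I z"
    and sol: "follower_solution I r z x y" and feas: "follower_feasible I r z x' y'"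
  let ?V = "{(ride_cost I x y, inconvenience I x y) | x y. follower_feasible I r z x y}"
    and ?f = "\<lambda>(b, f). M * b + f"
  have "?V \<noteq> {}"
    using feas by blast
  with finite_route_values[of I r z] obtain q where "q \<in> ?V" "\<And>q'. q' \<in> ?V \<Longrightarrow> ?f q \<le> ?f q'"
    using arg_min_if_finite(1)[of ?V ?f] arg_min_least[of ?V _ ?f] by blast
  then obtain x0 y0 where feas0: "follower_feasible I r z x0 y0"
    and min: "\<And>x' y'. follower_feasible I r z x' y' \<Longrightarrow>
      M * ride_cost I x0 y0 + inconvenience I x0 y0 \<le> M * ride_cost I x' y' + inconvenience I x' y'"
    by fastforce
  have "follower_solution I r z x0 y0"
    using M r z feas0 min unfolding suitably_large_def by blast
  then show "route_cost I (tau_hat I M) (gamma_hat I M) x y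
      \<le> route_cost I (tau_hat I M) (gamma_hat I M) x' y'"
    using follower_solution_unique_values[OF sol] min[OF feas] by (simp add: route_cost_hat)
qed

text \<open>Weak duality speaks only of routes on \<open>direct_arcs\<close>. Such a route that is
  lexicographically no worse is itself a solution, hence costs no more than the given one and
  transfers the bound to it.\<close>

lemma optimality_cut_bound:
  fixes I :: "('n::finite, 'r) odmts"
  assumes I: "odmts_instance I" and suffice: "direct_arcs_suffice I"
    and min: "follower_minimizes I bus shuttle"
    and r: "r \<in> trips I" and z: "is_design I z" and sol: "follower_solution I r z x y"
    and dual: "(u, v) \<in> dual_polyhedron I bus shuttle r"
  shows "u $ orig I r - u $ dest I r - (\<Sum>h\<in>hubs I. \<Sum>l\<in>hubs I. z h l * v $ (h, l))
    \<le> route_cost I bus shuttle x y"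
proof -
  have feas: "follower_feasible I r z x y"
    using sol by (simp add: follower_solution_def)
  obtain x' y' where feas': "follower_feasible I r z x' y'"
    and direct: "\<And>i j. (i, j) \<notin> direct_arcs I r \<Longrightarrow> y' i j = 0"
    and le: "lex_le (ride_cost I x' y', inconvenience I x' y') (ride_cost I x y, inconvenience I x y)"
    using suffice r z feas unfolding direct_arcs_suffice_def by meson
  have "follower_solution I r z x' y'"
    unfolding follower_solution_def
  proof (intro conjI allI impI)
    fix x'' y'' assume "follower_feasible I r z x'' y''"
    then have "lex_le (ride_cost I x y, inconvenience I x y) (ride_cost I x'' y'', inconvenience I x'' y'')"
      using sol by (simp add: follower_solution_def)
    with le show "lex_le (ride_cost I x' y', inconvenience I x' y') (ride_cost I x'' y'', inconvenience I x'' y'')"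
      by (auto simp: lex_le_def)
  qed (rule feas')
  then have "route_cost I bus shuttle x' y' \<le> route_cost I bus shuttle x y"
    using min r z feas unfolding follower_minimizes_def by blast
  moreover have "orig I r \<noteq> dest I r"
    using I r by (simp add: odmts_instance_def)
  ultimately show ?thesis
    using weak_duality[OF feas' _ direct dual] by linarith
qed

text \<open>The cut of the vertex from strong duality evaluates at \<open>z\<close> to the cost of a
  feasible route, which the follower solution does not exceed.\<close>

lemma optimality_cuts_imp_bound:
  fixes I :: "('n::finite, 'r) odmts"
  assumes I: "odmts_instance I" and min: "follower_minimizes I bus shuttle"
    and nonneg: "\<And>i j. 0 \<le> bus i j" "\<And>i j. 0 \<le> shuttle i j"
    and r: "r \<in> trips I" and z: "is_design I z" and sol: "follower_solution I r z x y"
    and cuts: "optimality_cuts I bus shuttle z b"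
  shows "route_cost I bus shuttle x y \<le> b r"
proof -
  have ends: "orig I r \<noteq> dest I r" and arcs: "direct_arcs I r \<subseteq> shuttles I r"
    using I r by (auto simp: odmts_instance_def)
  obtain x' y' u v where feas: "follower_feasible I r z x' y'"
    and ext: "(u, v) extreme_point_of dual_polyhedron I bus shuttle r"
    and eq: "route_cost I bus shuttle x' y'
       = u $ orig I r - u $ dest I r - (\<Sum>h\<in>hubs I. \<Sum>l\<in>hubs I. z h l * v $ (h, l))"
    by (rule strong_duality_extreme_point[OF z ends arcs nonneg])
  have "route_cost I bus shuttle x y \<le> route_cost I bus shuttle x' y'"
    using min r z sol feas unfolding follower_minimizes_def by blast
  also have "\<dots> \<le> b r"
    unfolding eq using cuts r ext unfolding optimality_cuts_def by blast
  finally show ?thesis .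
qed

section \<open>Consistency cuts\<close>

definition hamming :: "('n::finite, 'r) odmts \<Rightarrow> ('n \<Rightarrow> 'n \<Rightarrow> real) \<Rightarrow> ('n \<Rightarrow> 'n \<Rightarrow> real) \<Rightarrow> real" where
  "hamming I zb z = (\<Sum>(h, l) | (h, l) \<in> hubs I \<times> hubs I \<and> zb h l = 0. z h l)
     + (\<Sum>(h, l) | (h, l) \<in> hubs I \<times> hubs I \<and> zb h l = 1. 1 - z h l)"

lemma hamming_refl: "hamming I z z = 0"
proof -
  have "(\<Sum>(h, l) | (h, l) \<in> hubs I \<times> hubs I \<and> z h l = 0. z h l) = 0"
    by (rule sum.neutral) auto
  moreover have "(\<Sum>(h, l) | (h, l) \<in> hubs I \<times> hubs I \<and> z h l = 1. 1 - z h l) = 0"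
    by (rule sum.neutral) auto
  ultimately show ?thesis
    by (simp add: hamming_def)
qed

lemma hamming_nonneg:
  assumes "is_design I z"
  shows "0 \<le> hamming I zb z"
proof -
  have "0 \<le> z h l \<and> z h l \<le> 1" if "h \<in> hubs I" "l \<in> hubs I" for h l
    using assms that by (force simp: is_design_def)
  then show ?thesis
    unfolding hamming_def by (intro add_nonneg_nonneg sum_nonneg) auto
qed

lemma hamming_ge_1:
  fixes I :: "('n::finite, 'r) odmts"
  assumes zb: "is_design I zb" and z: "is_design I z"
    and hl: "h \<in> hubs I" "l \<in> hubs I" "zb h l \<noteq> z h l"
  shows "1 \<le> hamming I zb z"
proof -
  let ?A0 = "{(h, l). (h, l) \<in> hubs I \<times> hubs I \<and> zb h l = 0}"
    and ?A1 = "{(h, l). (h, l) \<in> hubs I \<times> hubs I \<and> zb h l = 1}"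
  have z01: "z h l = 0 \<or> z h l = 1" if "h \<in> hubs I" "l \<in> hubs I" for h l
    using z that by (auto simp: is_design_def)
  have nonneg0: "0 \<le> case_prod z a" if "a \<in> ?A0" for a
    using that z01 by fastforce
  have nonneg1: "0 \<le> (case a of (h, l) \<Rightarrow> 1 - z h l)" if "a \<in> ?A1" for a
    using that z01 by fastforce
  have sums: "0 \<le> sum (case_prod z) ?A0" "0 \<le> (\<Sum>(h, l)\<in>?A1. 1 - z h l)"
    by (rule sum_nonneg, erule nonneg0) (rule sum_nonneg, erule nonneg1)
  \<comment> \<open>The direction in which the leg differs decides which of the two sums contains
    its unit contribution.\<close>
  consider "zb h l = 0" "z h l = 1" | "zb h l = 1" "z h l = 0"
    using zb z01 hl by (fastforce simp: is_design_def)
  then show ?thesis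
  proof cases
    case 1
    then have "case_prod z (h, l) \<le> sum (case_prod z) ?A0"
      using hl nonneg0 by (intro member_le_sum) auto
    then show ?thesis
      using 1 sums(2) by (simp add: hamming_def)
  next
    case 2
    then have "(case (h, l) of (h, l) \<Rightarrow> 1 - z h l) \<le> (\<Sum>(h, l)\<in>?A1. 1 - z h l)"
      using hl nonneg1 by (intro member_le_sum) auto
    then show ?thesis
      using 2 sums(1) by (simp add: hamming_def)
  qed
qed

text \<open>Designs equal on hub pairs may differ as functions. Their solution predicates are equal,
  so \<open>SOME\<close> even picks the same pair.\<close>

lemma design_choice_cong:
  assumes "\<And>h l. h \<in> hubs I \<Longrightarrow> l \<in> hubs I \<Longrightarrow> z h l = z' h l"
  shows "design_choice I r z = design_choice I r z'"
proof -
  have "follower_solution I r z = follower_solution I r z'"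
    by (intro ext follower_solution_cong assms)
  then show ?thesis
    by (simp add: design_choice_def)
qed

text \<open>The cut at \<open>zb = z\<close> has distance 0 and forces the value of
  \<open>\<delta>\<close>. Conversely, a design that differs on some leg has distance at least 1,
  making its cut slack, and one that agrees on all legs has the same choice value.\<close>

lemma consistency_cuts_iff:
  fixes I :: "('n::finite, 'r) odmts"
  assumes I: "odmts_instance I" and leader: "leader_feasible I z \<delta>"
  shows "consistency_cuts I z \<delta> \<longleftrightarrow> (\<forall>r\<in>choice_trips I. \<delta> r = design_choice I r z)"
proof -
  have z: "is_design I z" and \<delta>: "\<And>r. r \<in> choice_trips I \<Longrightarrow> \<delta> r = 0 \<or> \<delta> r = 1"
    using leader by (auto simp: leader_feasible_def)
  have dc: "design_choice I r zb = 0 \<or> design_choice I r zb = 1" for r zb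
    by (simp add: design_choice_def choice_def split: prod.split)
  have cuts: "consistency_cuts I z \<delta> \<longleftrightarrow> (\<forall>r\<in>choice_trips I. \<forall>zb. is_design I zb \<longrightarrow>
      (design_choice I r zb = 0 \<longrightarrow> \<delta> r \<le> hamming I zb z) \<and>
      (design_choice I r zb = 1 \<longrightarrow> 1 \<le> hamming I zb z + \<delta> r))"
    by (simp add: consistency_cuts_def hamming_def)
  show ?thesis
  proof
    assume "consistency_cuts I z \<delta>"
    then have *: "(design_choice I r z = 0 \<longrightarrow> \<delta> r \<le> 0) \<and> (design_choice I r z = 1 \<longrightarrow> 1 \<le> \<delta> r)"
      if "r \<in> choice_trips I" for r
      using that z unfolding cuts by (metis hamming_refl add_0)
    show "\<forall>r\<in>choice_trips I. \<delta> r = design_choice I r z"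
    proof
      fix r assume r: "r \<in> choice_trips I"
      show "\<delta> r = design_choice I r z"
        using *[OF r] dc[of r z] \<delta>[OF r] by auto
    qed
  next
    assume eq: "\<forall>r\<in>choice_trips I. \<delta> r = design_choice I r z"
    show "consistency_cuts I z \<delta>"
      unfolding cuts
    proof (intro ballI allI impI)
      fix r zb assume r: "r \<in> choice_trips I" and zb: "is_design I zb"
      show "(design_choice I r zb = 0 \<longrightarrow> \<delta> r \<le> hamming I zb z) \<and>
        (design_choice I r zb = 1 \<longrightarrow> 1 \<le> hamming I zb z + \<delta> r)"
      proof (cases "\<exists>h\<in>hubs I. \<exists>l\<in>hubs I. zb h l \<noteq> z h l")
        case True
        then have "1 \<le> hamming I zb z"
          using hamming_ge_1[OF zb z] by blast
        then show ?thesis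
          using \<delta>[OF r] by auto
      next
        case False
        then have same: "zb h l = z h l" if "h \<in> hubs I" "l \<in> hubs I" for h l
          using that by blast
        have "0 \<le> hamming I zb z"
          using z by (rule hamming_nonneg)
        then show ?thesis
          using eq r design_choice_cong[of I zb z r, OF same] by auto
      qed
    qed
  qed
qed

section \<open>Equivalence\<close>

text \<open>Puts (B) in the shape of (E): what then separates them is follower solutions against
  optimality cuts.\<close>

lemma B_feasible_iff:
  assumes "odmts_instance I"
  shows "B_feasible I z \<delta> x y \<longleftrightarrow> leader_feasible I z \<delta> \<and> consistency_cuts I z \<delta> \<and>
    (\<forall>r\<in>trips I. follower_solution I r z (x r) (y r))"
proof -
  have "choice_trips I \<subseteq> trips I"
    using assms by (simp add: odmts_instance_def)
  then have "(\<forall>r\<in>choice_trips I. \<delta> r = choice I r (x r) (y r)) \<longleftrightarrow>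
      (\<forall>r\<in>choice_trips I. \<delta> r = design_choice I r z)"
    if sol: "\<forall>r\<in>trips I. follower_solution I r z (x r) (y r)"
    using design_choice_eq_choice sol by (metis subsetD)
  then show ?thesis
    unfolding B_feasible_def using consistency_cuts_iff[OF assms, of z \<delta>] by blast
qed

lemma problems_equivalent_if_follower_minimizes:
  fixes I :: "('n::finite, 'r) odmts"
  assumes I: "odmts_instance I" and suffice: "direct_arcs_suffice I"
    and min: "follower_minimizes I bus shuttle"
    and nonneg: "\<And>i j. 0 \<le> bus i j" "\<And>i j. 0 \<le> shuttle i j"
  shows "problems_equivalent I bus shuttle"
proof -
  let ?b = "\<lambda>x y r. route_cost I bus shuttle (x r) (y r)"
  have B_to_E: "E_feasible I bus shuttle z \<delta> (?b x y)" if B: "B_feasible I z \<delta> x y" for z \<delta> x y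
  proof -
    have z: "is_design I z"
      using B by (simp add: B_feasible_iff[OF I] leader_feasible_def)
    have "optimality_cuts I bus shuttle z (?b x y)"
      unfolding optimality_cuts_def extreme_point_of_def
      using optimality_cut_bound[OF I suffice min _ z] B by (auto simp: B_feasible_iff[OF I])
    then show ?thesis
      using B by (simp add: B_feasible_iff[OF I] E_feasible_def)
  qed
  have E_to_B: "\<exists>x y. B_feasible I z \<delta> x y \<and> B_objective I bus shuttle z \<delta> x y \<le> objective I z \<delta> b"
    if E: "E_feasible I bus shuttle z \<delta> b" for z \<delta> b
  proof -
    have leader: "leader_feasible I z \<delta>" and z: "is_design I z"
      and cuts: "optimality_cuts I bus shuttle z b"
      using E by (auto simp: E_feasible_def leader_feasible_def)
    have "\<forall>r\<in>trips I. \<exists>x y. follower_solution I r z x y"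
      using follower_solution_exists[OF I _ z] by blast
    then obtain x y where sol: "\<forall>r\<in>trips I. follower_solution I r z (x r) (y r)"
      by metis
    have B: "B_feasible I z \<delta> x y"
      using E sol by (simp add: B_feasible_iff[OF I] E_feasible_def)
    have le: "?b x y r \<le> b r" if "r \<in> trips I" for r
      using optimality_cuts_imp_bound[OF I min nonneg that z _ cuts] sol that by blast
    \<comment> \<open>The trip values enter the objective with weights \<open>riders\<close> and
      \<open>riders\<close> times \<open>\<delta>\<close>, all nonnegative, so the objective is
      monotone in them.\<close>
    have "\<And>r. r \<in> choice_trips I \<Longrightarrow> r \<in> trips I \<and> 0 \<le> \<delta> r"
      using I leader by (fastforce simp: odmts_instance_def leader_feasible_def)
    then have "objective I z \<delta> (?b x y) \<le> objective I z \<delta> b"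
      unfolding objective_def using le
      by (intro add_mono sum_mono order_refl) (auto intro!: mult_left_mono)
    then show ?thesis
      using B by (auto simp: B_objective_def)
  qed
  show ?thesis
    unfolding problems_equivalent_def
  proof (intro conjI allI impI)
    \<comment> \<open>A competitor in (E) dominates some feasible point of (B), whose objective is
      at least the optimum of (B).\<close>
    fix z \<delta> x y assume "B_optimal I bus shuttle z \<delta> x y"
    then show "E_optimal I bus shuttle z \<delta> (?b x y)"
      unfolding B_optimal_def E_optimal_def B_objective_def[of I bus shuttle z \<delta> x y]
      using B_to_E E_to_B by (meson order_trans)
  next
    fix z \<delta> b assume E: "E_optimal I bus shuttle z \<delta> b"
    then obtain x y where B: "B_feasible I z \<delta> x y"
      and le: "B_objective I bus shuttle z \<delta> x y \<le> objective I z \<delta> b"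
      using E_to_B unfolding E_optimal_def by blast
    \<comment> \<open>Points of (B) embed in (E) with the same objective value, so the optimum of
      (E) bounds (B) from below. Together with \<open>le\<close> this forces equality.\<close>
    have ge: "objective I z \<delta> b \<le> B_objective I bus shuttle z' \<delta>' x' y'"
      if "B_feasible I z' \<delta>' x' y'" for z' \<delta>' x' y'
      using E B_to_E[OF that] unfolding E_optimal_def B_objective_def by blast
    show "\<exists>x y. B_optimal I bus shuttle z \<delta> x y \<and> B_objective I bus shuttle z \<delta> x y = objective I z \<delta> b"
      using B le ge order_trans[OF le ge] unfolding B_optimal_def by (meson order_antisym)
  qed (use B_to_E E_to_B in blast)+
qed

theorem theorem1:
  fixes I :: "('n::finite, 'r) odmts"
  assumes "odmts_instance I"
    and "direct_arcs_suffice I"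
  shows "problems_equivalent I (tau I) (gamma I) \<and>
         (\<forall>M. suitably_large I M \<longrightarrow> problems_equivalent I (tau_hat I M) (gamma_hat I M))"
proof (intro conjI allI impI)
  have nonneg: "0 \<le> tau I i j" "0 \<le> gamma I i j" "0 \<le> time I i j" "0 \<le> wait I" for i j
    using assms(1) by (auto simp: odmts_instance_def tau_def gamma_def)
  show "problems_equivalent I (tau I) (gamma I)"
    using assms follower_minimizes_ride_cost nonneg(1,2)
    by (rule problems_equivalent_if_follower_minimizes)
  fix M assume M: "suitably_large I M"
  \<comment> \<open>Positivity of \<open>M\<close> keeps the scaled costs nonnegative, as the
    shortest-path argument requires.\<close>
  then have "0 < M"
    by (simp add: suitably_large_def)
  then have "0 \<le> tau_hat I M i j" "0 \<le> gamma_hat I M i j" for i j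
    using nonneg by (auto simp: tau_hat_def gamma_hat_def)
  with assms follower_minimizes_hat[OF assms(1) M]
  show "problems_equivalent I (tau_hat I M) (gamma_hat I M)"
    by (rule problems_equivalent_if_follower_minimizes)
qed

end
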